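(* Let $R$ be a finite local ring with $|R|=q^n$ and $R/J=GF(q)$, where $n$ is a positive integer, and suppose that $J^{n-1} \neq 0$. If $x \in J^k \setminus J^{k+1}$ for some integer $k \geq 0$, then $\mathrm{Prob}_x(R)=\frac{(k+1)(q-1)}{q^{n+1}}$. Furthermore, $\mathrm{Prob}_0(R)=\frac{(n+1)q-n}{q^{n+1}}$.
   Context: Rings are associative with unity $1$, not necessarily commutative. $J=J(R)$ is the Jacobson radical of $R$, with the convention $J^0=R$, and $GF(q)$ is the finite field with $q$ elements ($R/J=GF(q)$ means isomorphic as rings). For a finite ring $R$ and $x \in R$, the multiplication probability is $\mathrm{Prob}_x(R)=\frac{|\{(a,b) \in R^2 : ab=x\}|}{|R|^2}$. *)

theory Defs
  imports Complex_Main "HOL-Algebra.Algebra"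
begin

(* The ideals of HOL-Algebra are two-sided and its rings are associative with unity but not
   necessarily commutative, so left ideals have to be introduced separately. *)

locale left_ideal = additive_subgroup I R + ring R for I and R (structure) +
  assumes l_closed: "\<lbrakk>a \<in> I; x \<in> carrier R\<rbrakk> \<Longrightarrow> x \<otimes> a \<in> I"

locale maximal_left_ideal = left_ideal +
  assumes proper: "I \<noteq> carrier R"
    and maximal: "\<lbrakk>left_ideal L R; I \<subseteq> L\<rbrakk> \<Longrightarrow> L = I \<or> L = carrier R"

locale local_ring = ring R for R (structure) +
  assumes unique_maximal: "\<exists>!M. maximal_left_ideal M R"

(* Intersecting with the carrier matters only if there is no maximal left ideal: the empty
   intersection is then the whole ring instead of UNIV. *)
definition jacobson_radical :: "('a, 'b) ring_scheme \<Rightarrow> 'a set"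
  where "jacobson_radical R = carrier R \<inter> \<Inter>{M. maximal_left_ideal M R}"

(* Multiplication in ideals_set R is the product of ideals (finite sums of products) and its
   unit is carrier R, so that the zeroth power is the whole ring. *)
definition ideal_power :: "('a, 'b) ring_scheme \<Rightarrow> 'a set \<Rightarrow> nat \<Rightarrow> 'a set"
  where "ideal_power R I k = I [^]\<^bsub>ideals_set R\<^esub> k"

lemma ideal_power_0: "ideal_power R I 0 = carrier R"
  by (simp add: ideal_power_def nat_pow_def ideals_set_def)

lemma ideal_power_Suc: "ideal_power R I (Suc k) = ideal_power R I k \<cdot>\<^bsub>R\<^esub> I"
  by (simp add: ideal_power_def nat_pow_def ideals_set_def)

(* A finite field is determined up to isomorphism by its order. *)
definition is_GF :: "('a, 'b) ring_scheme \<Rightarrow> nat \<Rightarrow> bool"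
  where "is_GF F q \<longleftrightarrow> field F \<and> finite (carrier F) \<and> order F = q"

definition mult_prob :: "('a, 'b) ring_scheme \<Rightarrow> 'a \<Rightarrow> real"
  where "mult_prob R x =
    real (card {(a, b) \<in> carrier R \<times> carrier R. a \<otimes>\<^bsub>R\<^esub> b = x}) / (real (order R))\<^sup>2"

end

theory Submission
  imports Defs
begin

text \<open>
  In a finite local ring \<open>R\<close> the radical \<open>J\<close> is exactly the set of nonunits. If \<open>L\<close> is a left ideal
  and \<open>m \<notin> L\<close>, then multiples of \<open>m\<close> by elements that are distinct modulo \<open>J\<close> are distinct modulo
  \<open>L\<close>, so that \<open>|R m + L| \<ge> q |L|\<close> (\<open>card_residue_mult_le\<close>). By Nakayama's lemma (\<open>nakayama\<close>) the
  powers of \<open>J\<close> decrease strictly until they vanish; since \<open>J^(n-1) \<noteq> 0\<close>, this gives at least \<open>n\<close>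
  strict steps, each of index at least \<open>q\<close>. As \<open>|R| = q^n\<close>, there are exactly \<open>n\<close> steps, each of index
  exactly \<open>q\<close>: \<open>|J^i| = q^(n-i)\<close> for \<open>i \<le> n\<close> (\<open>card_Jpow\<close>).

  Hence an element \<open>b\<close> of \<open>J^i - J^(i+1)\<close> satisfies \<open>R b + J^(i+1) = J^i\<close>, and Nakayama's lemma gives
  \<open>R b = J^i\<close> (\<open>PIdl_eq_Jpow\<close>). The additive map \<open>a \<mapsto> a b\<close> therefore has image \<open>J^i\<close> and fibres of
  size \<open>q^i\<close> over it (\<open>card_fibre\<close>). There are \<open>(q-1) q^(n-i-1)\<close> such elements \<open>b\<close>, so for \<open>i < n\<close> each
  layer \<open>J^i - J^(i+1)\<close> contributes \<open>(q-1) q^(n-1)\<close> factorizations \<open>a b = x\<close> of an \<open>x\<close> in \<open>J^i\<close>,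
  independently of \<open>i\<close>. For \<open>x\<close> in \<open>J^k - J^(k+1)\<close> exactly the layers with \<open>i \<le> k\<close> contribute; for
  \<open>x = 0\<close> all \<open>n\<close> layers do, and \<open>b = 0\<close> contributes \<open>q^n\<close> further pairs.
\<close>

\<comment> \<open>Leaves \<open><+>\<close> to the sum of two subsets of a ring.\<close>
no_notation Sum_Type.Plus (infixr \<open><+>\<close> 65)

section \<open>Left ideals\<close>

text \<open>By definition \<open>PIdl b\<close> is the set of left multiples of \<open>b\<close>; it is an ideal in the commutative
  case, but only a left ideal in general.\<close>

lemma (in ring) PIdl_left_ideal:
  assumes "b \<in> carrier R"
  shows "left_ideal (PIdl b) R"
proof -
  have "subgroup (PIdl b) (add_monoid R)"
  proof (rule add.subgroupI)
    show "PIdl b \<subseteq> carrier R" "PIdl b \<noteq> {}"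
      using assms by (auto simp: cgenideal_def)
  next
    fix y assume "y \<in> PIdl b"
    then obtain r where "r \<in> carrier R" "y = r \<otimes> b" by (auto simp: cgenideal_def)
    then show "\<ominus> y \<in> PIdl b"
      using assms by (auto simp: cgenideal_def intro!: exI[of _ "\<ominus> r"] simp: l_minus)
  next
    fix y z assume "y \<in> PIdl b" "z \<in> PIdl b"
    then obtain r s where "r \<in> carrier R" "y = r \<otimes> b" "s \<in> carrier R" "z = s \<otimes> b"
      by (auto simp: cgenideal_def)
    then show "y \<oplus> z \<in> PIdl b"
      using assms by (auto simp: cgenideal_def intro!: exI[of _ "r \<oplus> s"] simp: l_distr)
  qed
  moreover have "x \<otimes> a \<in> PIdl b" if "a \<in> PIdl b" "x \<in> carrier R" for a x
  proof -
    from that obtain r where "r \<in> carrier R" "a = r \<otimes> b" by (auto simp: cgenideal_def)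
    then show ?thesis
      using assms that by (auto simp: cgenideal_def intro!: exI[of _ "x \<otimes> r"] simp: m_assoc)
  qed
  ultimately show ?thesis
    by (intro left_ideal.intro additive_subgroupI left_ideal_axioms.intro ring_axioms)
qed

lemma (in ring) self_in_PIdl: "b \<in> carrier R \<Longrightarrow> b \<in> PIdl b"
  by (auto simp: cgenideal_def intro!: exI[of _ "\<one>"])

lemma (in ring) set_add_left_ideal:
  assumes "left_ideal A R" "left_ideal B R"
  shows "left_ideal (A <+> B) R"
proof -
  interpret A: left_ideal A R by fact
  interpret B: left_ideal B R by fact
  have "additive_subgroup (A <+> B) R"
    by (rule add_additive_subgroups) unfold_locales
  moreover have "x \<otimes> a \<in> A <+> B" if "a \<in> A <+> B" and x: "x \<in> carrier R" for a x
  proof -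
    from that obtain u v where "u \<in> A" "v \<in> B" "a = u \<oplus> v"
      by (auto simp: set_add_def')
    then show ?thesis
      using x A.l_closed[of u x] B.l_closed[of v x] A.a_Hcarr B.a_Hcarr
      by (auto simp: set_add_def' r_distr)
  qed
  ultimately show ?thesis
    by (intro left_ideal.intro left_ideal_axioms.intro ring_axioms)
qed

lemma (in ring) ideal_imp_left_ideal: "ideal I R \<Longrightarrow> left_ideal I R"
  by (simp add: ideal_def ideal_axioms_def left_ideal_def left_ideal_axioms_def)

lemma (in left_ideal) one_imp_carrier:
  assumes "\<one> \<in> I"
  shows "I = carrier R"
  using a_subset l_closed[OF assms] by force

lemma (in left_ideal) PIdl_subset: "b \<in> I \<Longrightarrow> PIdl b \<subseteq> I"
  by (auto simp: cgenideal_def l_closed)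

lemma (in ring) set_add_least:
  assumes "additive_subgroup C R" "A \<subseteq> C" "B \<subseteq> C"
  shows "A <+> B \<subseteq> C"
  using assms additive_subgroup.a_closed[OF assms(1)] by (fastforce simp: set_add_def')

lemma (in ring) set_add_upper:
  assumes "additive_subgroup A R" "additive_subgroup B R"
  shows "A \<subseteq> A <+> B" "B \<subseteq> A <+> B"
proof -
  interpret A: additive_subgroup A R by fact
  interpret B: additive_subgroup B R by fact
  show "A \<subseteq> A <+> B"
  proof
    fix x assume "x \<in> A"
    then have "x = x \<oplus> \<zero>" by simp
    with \<open>x \<in> A\<close> B.zero_closed show "x \<in> A <+> B"
      unfolding set_add_def' by blast
  qed
  show "B \<subseteq> A <+> B"
  proof
    fix x assume "x \<in> B"
    then have "x = \<zero> \<oplus> x" by simp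
    with \<open>x \<in> B\<close> A.zero_closed show "x \<in> A <+> B"
      unfolding set_add_def' by blast
  qed
qed

lemma (in ring) set_add_zero:
  assumes "A \<subseteq> carrier R"
  shows "{\<zero>} <+> A = A"
  using assms by (force simp: set_add_def')

section \<open>Finite local rings\<close>

text \<open>The definition of a local ring speaks of left ideals only; that the radical is two-sided is
  proved below, from finiteness.\<close>

locale finite_local_ring = local_ring +
  assumes finite_carrier: "finite (carrier R)"
begin

abbreviation J :: "'a set" where "J \<equiv> jacobson_radical R"

abbreviation Jpow :: "nat \<Rightarrow> 'a set" where "Jpow \<equiv> ideal_power R J"

lemma maximal_left_ideal_J: "maximal_left_ideal J R"
proof -
  obtain M where M: "maximal_left_ideal M R" "\<And>N. maximal_left_ideal N R \<Longrightarrow> N = M"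
    using unique_maximal by blast
  then have "{N. maximal_left_ideal N R} = {M}" by blast
  moreover have "M \<subseteq> carrier R"
    by (rule additive_subgroup.a_subset[OF left_ideal.axioms(1)[OF maximal_left_ideal.axioms(1)[OF M(1)]]])
  ultimately show ?thesis
    using M(1) by (simp add: jacobson_radical_def Int_absorb1)
qed

sublocale J: maximal_left_ideal J R
  by (rule maximal_left_ideal_J)

lemma finite_left_ideals: "finite {L. left_ideal L R \<and> P L}"
proof (rule finite_subset)
  show "{L. left_ideal L R \<and> P L} \<subseteq> Pow (carrier R)"
    using additive_subgroup.a_subset[OF left_ideal.axioms(1)] by blast
  show "finite (Pow (carrier R))" using finite_carrier by simp
qed

lemma proper_left_ideal_subset_J:
  assumes "left_ideal L R" "L \<noteq> carrier R"
  shows "L \<subseteq> J"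
proof -
  obtain M where M: "left_ideal M R" "M \<noteq> carrier R" "L \<subseteq> M"
    and max: "\<And>N. left_ideal N R \<Longrightarrow> N \<noteq> carrier R \<Longrightarrow> M \<subseteq> N \<Longrightarrow> M = N"
    using finite_has_maximal2[OF finite_left_ideals[of "\<lambda>L. L \<noteq> carrier R"], of L] assms by auto
  have "maximal_left_ideal M R"
    by (intro maximal_left_ideal.intro maximal_left_ideal_axioms.intro M) (use max in blast)
  then have "M = J"
    using unique_maximal maximal_left_ideal_J by blast
  with M show ?thesis by simp
qed

lemma left_inverse_imp_Unit:
  assumes a: "a \<in> carrier R" and b: "b \<in> carrier R" and ba: "b \<otimes> a = \<one>"
  shows "a \<in> Units R" "b \<in> Units R"
proof -
  \<comment> \<open>Multiplication by \<open>a\<close> on the left is injective, hence surjective.\<close>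
  have "inj_on (\<lambda>x. a \<otimes> x) (carrier R)"
    by (rule inj_onI) (metis a b ba l_one m_assoc)
  then have "(\<lambda>x. a \<otimes> x) ` carrier R = carrier R"
    using a finite_carrier by (intro card_subset_eq) (auto simp: card_image)
  then obtain c where c: "c \<in> carrier R" "a \<otimes> c = \<one>"
    by (metis imageE one_closed)
  have "c = b"
    by (metis a b ba c l_one m_assoc r_one)
  with a b ba c show "a \<in> Units R" "b \<in> Units R"
    by (auto simp: Units_def)
qed

lemma Units_iff_notin_J:
  assumes "x \<in> carrier R"
  shows "x \<in> Units R \<longleftrightarrow> x \<notin> J"
proof
  assume "x \<in> Units R"
  then have "x \<in> J \<Longrightarrow> \<one> \<in> J"
    using J.l_closed[of x "inv x"] by simp
  then show "x \<notin> J"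
    using J.one_imp_carrier J.proper by blast
next
  assume "x \<notin> J"
  moreover have "x \<in> PIdl x"
    using assms by (rule self_in_PIdl)
  ultimately have "PIdl x = carrier R"
    using proper_left_ideal_subset_J[OF PIdl_left_ideal[OF assms]] by blast
  then have "\<one> \<in> PIdl x" by simp
  then obtain r where "r \<in> carrier R" "r \<otimes> x = \<one>"
    unfolding cgenideal_def by auto
  then show "x \<in> Units R"
    using left_inverse_imp_Unit assms by blast
qed

lemma ideal_J: "ideal J R"
proof (rule idealI)
  show "ring R" by (rule ring_axioms)
  show "subgroup J (add_monoid R)" by (rule J.a_subgroup)
  show "x \<otimes> a \<in> J" if "a \<in> J" "x \<in> carrier R" for a x
    using that by (rule J.l_closed)
  \<comment> \<open>If \<open>a \<otimes> x\<close> were a unit, then \<open>a\<close> would have a right inverse, hence be a unit itself.\<close>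
  show "a \<otimes> x \<in> J" if "a \<in> J" "x \<in> carrier R" for a x
  proof (rule ccontr)
    assume "a \<otimes> x \<notin> J"
    with that have u: "a \<otimes> x \<in> Units R"
      using Units_iff_notin_J J.a_Hcarr by simp
    have "a \<otimes> (x \<otimes> inv (a \<otimes> x)) = \<one>"
      using that J.a_Hcarr u by (simp add: m_assoc[symmetric])
    then have "a \<in> Units R"
      using that J.a_Hcarr u by (intro left_inverse_imp_Unit(2)[of "x \<otimes> inv (a \<otimes> x)"]) auto
    then show False
      using that J.a_Hcarr Units_iff_notin_J by blast
  qed
qed

text \<open>Nakayama's lemma, relative to a left ideal \<open>N\<close>. Finiteness provides a left ideal \<open>N'\<close> that is
  maximal among the proper left subideals of \<open>M\<close> containing \<open>N\<close>; as the quotient of \<open>M\<close> by \<open>N'\<close> is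
  simple, the radical annihilates it, so that \<open>N'\<close> contains both \<open>N\<close> and \<open>J \<cdot> M\<close>.\<close>

lemma nakayama:
  assumes N: "left_ideal N R" and M: "left_ideal M R" and "N \<subset> M"
  shows "N <+> J \<cdot> M \<noteq> M"
proof -
  interpret M: left_ideal M R by fact
  obtain N' where N': "left_ideal N' R" "N' \<subset> M" "N \<subseteq> N'"
    and max: "\<And>L. left_ideal L R \<Longrightarrow> L \<subset> M \<Longrightarrow> N' \<subseteq> L \<Longrightarrow> N' = L"
    using finite_has_maximal2[OF finite_left_ideals[of "\<lambda>L. L \<subset> M"], of N] assms
    by (metis (mono_tags, lifting) mem_Collect_eq)
  interpret N': left_ideal N' R by fact
  have *: "j \<otimes> m \<in> N'" if j: "j \<in> J" and m: "m \<in> M" for j m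
  proof (rule ccontr)
    assume notin: "j \<otimes> m \<notin> N'"
    have jc: "j \<in> carrier R" and mc: "m \<in> carrier R" and jmc: "j \<otimes> m \<in> carrier R"
      using j m by auto
    have jm: "j \<otimes> m \<in> PIdl (j \<otimes> m)"
      using jmc by (rule self_in_PIdl)
    let ?L = "PIdl (j \<otimes> m) <+> N'"
    have li: "left_ideal (PIdl (j \<otimes> m)) R"
      using jmc by (rule PIdl_left_ideal)
    note up = set_add_upper[OF left_ideal.axioms(1)[OF li] N'.additive_subgroup_axioms]
    have "?L \<subseteq> M"
      using M.PIdl_subset[of "j \<otimes> m"] M.l_closed[OF m jc] N'
      by (intro set_add_least M.additive_subgroup_axioms) auto
    moreover have "N' \<noteq> ?L"
      using notin jm up by blast
    ultimately have "?L = M"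
      using max[of ?L] set_add_left_ideal[OF li N'(1)] up by blast
    with m have "m \<in> ?L" by simp
    then obtain r y where r: "r \<in> carrier R" and y: "y \<in> N'" and m_eq: "m = r \<otimes> (j \<otimes> m) \<oplus> y"
      unfolding set_add_def' cgenideal_def by blast
    \<comment> \<open>Hence \<open>(\<one> \<ominus> r \<otimes> j) \<otimes> m \<in> N'\<close>, where \<open>\<one> \<ominus> r \<otimes> j\<close> is a unit.\<close>
    let ?u = "\<one> \<ominus> r \<otimes> j"
    have rj: "r \<otimes> j \<in> J" using j r by (rule J.l_closed)
    have uc: "?u \<in> carrier R" using r jc by simp
    have "?u \<notin> J"
    proof
      assume "?u \<in> J"
      then have "?u \<oplus> r \<otimes> j \<in> J" using rj by simp
      moreover have "?u \<oplus> r \<otimes> j = \<one>"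
        using r jc by (simp add: minus_eq a_assoc l_neg)
      ultimately show False
        using J.one_imp_carrier J.proper by simp
    qed
    then have u: "?u \<in> Units R" using Units_iff_notin_J uc by blast
    have "?u \<otimes> m = m \<ominus> r \<otimes> (j \<otimes> m)"
      using r jc mc by (simp add: minus_eq l_distr l_minus m_assoc)
    also have "\<dots> = (r \<otimes> (j \<otimes> m) \<oplus> y) \<ominus> r \<otimes> (j \<otimes> m)"
      using m_eq by simp
    also have "\<dots> = y"
      using r jmc N'.a_Hcarr[OF y] by (simp add: minus_eq a_assoc a_lcomm r_neg)
    finally have "?u \<otimes> m = y" .
    then have "inv ?u \<otimes> y = m"
      using u mc by (metis Units_inv_closed Units_l_inv uc l_one m_assoc)
    then have "m \<in> N'"
      using N'.l_closed[OF y, of "inv ?u"] u by simp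
    then show False
      using notin N'.l_closed jc by blast
  qed
  have "x \<in> N'" if "x \<in> J \<cdot> M" for x
    using that by (induction rule: ideal_prod.induct) (auto intro: *)
  then have "N <+> J \<cdot> M \<subseteq> N'"
    using N' by (intro set_add_least N'.additive_subgroup_axioms) auto
  with N' show ?thesis by blast
qed

text \<open>Two multiples \<open>r \<otimes> m\<close> and \<open>s \<otimes> m\<close> that agree modulo \<open>L\<close> have \<open>r \<ominus> s \<in> J\<close>: otherwise
  \<open>r \<ominus> s\<close> would be a unit and \<open>m\<close> would lie in \<open>L\<close>. So representatives of the residue classes of \<open>J\<close>
  multiply \<open>m\<close> into distinct cosets of \<open>L\<close>.\<close>

lemma card_residue_mult_le:
  assumes L: "left_ideal L R" and m: "m \<in> carrier R" "m \<notin> L"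
  shows "card (carrier (R Quot J)) * card L \<le> card (PIdl m <+> L)"
proof -
  interpret L: left_ideal L R by fact
  interpret JI: ideal J R by (rule ideal_J)
  let ?Q = "carrier (R Quot J)"
  define rep where "rep C = (SOME r. r \<in> carrier R \<and> J +> r = C)" for C
  have rep: "rep C \<in> carrier R" "J +> rep C = C" if "C \<in> ?Q" for C
  proof -
    have "\<exists>r. r \<in> carrier R \<and> J +> r = C"
      using that by (auto simp: FactRing_def A_RCOSETS_def')
    from someI_ex[OF this] show "rep C \<in> carrier R" "J +> rep C = C"
      unfolding rep_def by auto
  qed
  let ?f = "\<lambda>(C, l). rep C \<otimes> m \<oplus> l"
  have "inj_on ?f (?Q \<times> L)"
  proof (rule inj_onI, clarsimp)
    fix C l D k
    assume C: "C \<in> ?Q" and D: "D \<in> ?Q" and l: "l \<in> L" and k: "k \<in> L"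
      and eq: "rep C \<otimes> m \<oplus> l = rep D \<otimes> m \<oplus> k"
    note carr = rep(1)[OF C] rep(1)[OF D] L.a_Hcarr[OF l] L.a_Hcarr[OF k] m(1)
    let ?d = "rep C \<ominus> rep D"
    have "?d \<otimes> m = rep C \<otimes> m \<ominus> rep D \<otimes> m"
      using carr by (simp add: minus_eq l_distr l_minus)
    also have "\<dots> = (rep C \<otimes> m \<oplus> l) \<ominus> l \<ominus> rep D \<otimes> m"
      using carr by (simp add: minus_eq a_assoc r_neg)
    also have "\<dots> = (rep D \<otimes> m \<oplus> k) \<ominus> l \<ominus> rep D \<otimes> m"
      using eq by simp
    also have "\<dots> = k \<ominus> l"
      using carr by (simp add: minus_eq a_assoc a_lcomm r_neg)
    finally have dm: "?d \<otimes> m \<in> L"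
      using k l by (simp add: minus_eq)
    have "?d \<in> J"
    proof (rule ccontr)
      assume "?d \<notin> J"
      then have u: "?d \<in> Units R" using Units_iff_notin_J carr by simp
      have "inv ?d \<otimes> (?d \<otimes> m) = m"
        using u carr by (simp add: m_assoc[symmetric])
      then show False
        using L.l_closed[OF dm, of "inv ?d"] u m by simp
    qed
    then have "rep C \<in> J +> rep D"
      using JI.a_rcos_module_minus[OF ring_axioms] carr by blast
    then have "C = D"
      using JI.a_repr_independence' carr rep(2)[OF C] rep(2)[OF D] by metis
    moreover have "l = k"
      using eq carr \<open>C = D\<close> by simp
    ultimately show "C = D \<and> l = k" ..
  qed
  moreover have "?f ` (?Q \<times> L) \<subseteq> PIdl m <+> L"
    using rep(1) by (auto simp: set_add_def' cgenideal_def)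
  moreover have "PIdl m <+> L \<subseteq> carrier R"
    using m L.a_Hcarr by (auto simp: set_add_def' cgenideal_def)
  ultimately have "card (?Q \<times> L) \<le> card (PIdl m <+> L)"
    by (metis card_image card_mono finite_carrier finite_subset)
  then show ?thesis
    by (simp add: card_cartesian_product)
qed

section \<open>Powers of the radical\<close>

lemma ideal_Jpow: "ideal (Jpow i) R"
  by (induction i) (simp_all add: ideal_power_0 ideal_power_Suc oneideal ideal_prod_is_ideal ideal_J)

lemma left_ideal_Jpow: "left_ideal (Jpow i) R"
  by (simp add: ideal_imp_left_ideal ideal_Jpow)

lemma Jpow_subset_carrier: "Jpow i \<subseteq> carrier R"
  by (meson additive_subgroup.a_subset ideal.axioms(1) ideal_Jpow)

lemma finite_Jpow: "finite (Jpow i)"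
  using Jpow_subset_carrier finite_carrier finite_subset by blast

lemma zero_in_Jpow: "\<zero> \<in> Jpow i"
  by (meson additive_subgroup.zero_closed ideal.axioms(1) ideal_Jpow)

lemma Jpow_antimono: "i \<le> j \<Longrightarrow> Jpow j \<subseteq> Jpow i"
proof (rule lift_Suc_antimono_le[of Jpow])
  show "Jpow (Suc k) \<subseteq> Jpow k" for k
    using ideal_prod_inter[OF ideal_Jpow ideal_J] by (auto simp: ideal_power_Suc)
qed

text \<open>The recursion for powers multiplies by \<^term>\<open>J\<close> on the right, whereas Nakayama's lemma
  for left ideals needs it on the left.\<close>

lemma J_mult_Jpow: "J \<cdot> Jpow i = Jpow (Suc i)"
proof (induction i)
  case 0
  have "carrier R \<cdot> J = J"
  proof
    show "carrier R \<cdot> J \<subseteq> J"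
      using ideal_prod_inter[OF oneideal ideal_J] by blast
    show "J \<subseteq> carrier R \<cdot> J"
    proof
      fix x assume "x \<in> J"
      then show "x \<in> carrier R \<cdot> J"
        using ideal_prod.prod[of \<one> "carrier R" x J R] by simp
    qed
  qed
  then show ?case
    by (simp add: ideal_power_Suc ideal_power_0 ideal_prod_one ideal_J)
next
  case (Suc i)
  then show ?case
    by (metis ideal_power_Suc ideal_prod_assoc ideal_J ideal_Jpow)
qed

lemma Jpow_Suc_psubset:
  assumes "Jpow i \<noteq> {\<zero>}"
  shows "Jpow (Suc i) \<subset> Jpow i"
proof -
  have "{\<zero>} <+> Jpow (Suc i) \<noteq> Jpow i"
    using nakayama[of "{\<zero>}" "Jpow i"] assms zero_in_Jpow zeroideal
    by (auto simp: ideal_imp_left_ideal left_ideal_Jpow J_mult_Jpow)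
  then show ?thesis
    using set_add_zero[OF Jpow_subset_carrier] Jpow_antimono[of i "Suc i"] by auto
qed

end

section \<open>Local rings of maximal length\<close>

text \<open>The powers \<open>J^0, \<dots>, J^(n-1)\<close> are nonzero in a finite local ring with \<open>q^n\<close> elements and residue
  field of size \<open>q\<close>, so its chain of powers of the radical is as long as its order permits.\<close>

locale maximal_length_local_ring = finite_local_ring +
  fixes q n :: nat
  assumes n_pos: "n > 0"
    and order_eq: "order R = q ^ n"
    and card_residue: "card (carrier (R Quot J)) = q"
    and q_gt_1: "q > 1"
    and Jpow_nonzero: "Jpow (n - 1) \<noteq> {\<zero>}"
begin

lemma Jpow_neq_zero:
  assumes "i < n"
  shows "Jpow i \<noteq> {\<zero>}"
proof
  assume "Jpow i = {\<zero>}"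
  moreover have "Jpow (n - 1) \<subseteq> Jpow i"
    using assms by (intro Jpow_antimono) simp
  ultimately have "Jpow (n - 1) = {\<zero>}"
    using zero_in_Jpow[of "n - 1"] by blast
  with Jpow_nonzero show False ..
qed

lemma PIdl_add_Jpow_subset:
  assumes "b \<in> Jpow i"
  shows "PIdl b <+> Jpow (Suc i) \<subseteq> Jpow i"
proof -
  interpret I: left_ideal "Jpow i" R by (rule left_ideal_Jpow)
  show ?thesis
    using I.PIdl_subset[OF assms] Jpow_antimono[of i "Suc i"]
    by (intro set_add_least I.additive_subgroup_axioms) auto
qed

lemma card_Jpow_Suc_le:
  assumes "i < n"
  shows "q * card (Jpow (Suc i)) \<le> card (Jpow i)"
proof -
  obtain b where b: "b \<in> Jpow i" "b \<notin> Jpow (Suc i)"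
    using Jpow_Suc_psubset[OF Jpow_neq_zero[OF assms]] by blast
  then have "q * card (Jpow (Suc i)) \<le> card (PIdl b <+> Jpow (Suc i))"
    using card_residue_mult_le[OF left_ideal_Jpow, of b] Jpow_subset_carrier card_residue by blast
  also have "\<dots> \<le> card (Jpow i)"
    by (intro card_mono finite_Jpow PIdl_add_Jpow_subset b)
  finally show ?thesis .
qed

text \<open>Each of the \<open>n\<close> steps from \<open>J^0\<close> down to \<open>J^n\<close> has index at least \<open>q\<close>. Counting the steps above
  \<open>J^i\<close> bounds its size from above, counting those below bounds it from below.\<close>

lemma card_Jpow:
  assumes "i \<le> n"
  shows "card (Jpow i) = q ^ (n - i)"
proof (rule antisym)
  have "q ^ i * card (Jpow i) \<le> q ^ n"
    using assms
  proof (induction i)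
    case 0
    then show ?case using order_eq by (simp add: ideal_power_0 order_def)
  next
    case (Suc i)
    have "q ^ Suc i * card (Jpow (Suc i)) = q ^ i * (q * card (Jpow (Suc i)))" by simp
    also have "\<dots> \<le> q ^ i * card (Jpow i)"
      using card_Jpow_Suc_le[of i] Suc.prems by (intro mult_left_mono) auto
    also have "\<dots> \<le> q ^ n" using Suc by simp
    finally show ?case .
  qed
  also have "q ^ n = q ^ i * q ^ (n - i)"
    using assms by (simp flip: power_add)
  finally show "card (Jpow i) \<le> q ^ (n - i)"
    using q_gt_1 by simp
  show "q ^ (n - i) \<le> card (Jpow i)"
    using assms
  proof (induction rule: inc_induct)
    case base
    then show ?case
      using zero_in_Jpow finite_Jpow by (auto simp: Suc_le_eq card_gt_0_iff)
  next
    case (step i)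
    then have "q ^ (n - i) = q * q ^ (n - Suc i)"
      by (simp flip: power_Suc add: Suc_diff_Suc)
    also have "\<dots> \<le> card (Jpow i)"
      using step card_Jpow_Suc_le[of i] by (meson le_trans mult_left_mono zero_le)
    finally show ?case .
  qed
qed

lemma Jpow_n: "Jpow n = {\<zero>}"
  using card_Jpow[of n] zero_in_Jpow[of n] by (auto simp: card_1_singleton_iff)

text \<open>Every nonzero element generates, as a left ideal, the smallest power of the radical that
  contains it.\<close>

lemma PIdl_eq_Jpow:
  assumes i: "i < n" and b: "b \<in> Jpow i" "b \<notin> Jpow (Suc i)"
  shows "PIdl b = Jpow i"
proof (rule ccontr)
  assume neq: "PIdl b \<noteq> Jpow i"
  have bc: "b \<in> carrier R" using b Jpow_subset_carrier by blast
  have "card (Jpow i) = q * card (Jpow (Suc i))"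
    using i card_Jpow by (simp add: Suc_diff_Suc flip: power_Suc)
  also have "\<dots> \<le> card (PIdl b <+> Jpow (Suc i))"
    using card_residue_mult_le[OF left_ideal_Jpow bc b(2)] card_residue by simp
  finally have "PIdl b <+> Jpow (Suc i) = Jpow i"
    using PIdl_add_Jpow_subset[OF b(1)] finite_Jpow by (meson card_seteq)
  moreover have "PIdl b \<subset> Jpow i"
    using neq left_ideal.PIdl_subset[OF left_ideal_Jpow b(1)] by blast
  ultimately show False
    using nakayama[OF PIdl_left_ideal[OF bc] left_ideal_Jpow] by (simp add: J_mult_Jpow)
qed

section \<open>Counting factorizations\<close>

text \<open>The nonempty fibres of \<^term>\<open>\<lambda>a. a \<otimes> b\<close> are translates of its kernel.\<close>

lemma card_fibre:
  assumes i: "i < n" and b: "b \<in> Jpow i" "b \<notin> Jpow (Suc i)" and x: "x \<in> Jpow i"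
  shows "card {a \<in> carrier R. a \<otimes> b = x} = q ^ i"
proof -
  define fib where "fib y = {a \<in> carrier R. a \<otimes> b = y}" for y
  have bc: "b \<in> carrier R" using b Jpow_subset_carrier by blast
  have Rb: "(\<lambda>a. a \<otimes> b) ` carrier R = Jpow i"
    unfolding PIdl_eq_Jpow[OF i b, symmetric] cgenideal_def by blast
  have card_eq: "card (fib y) = card (fib \<zero>)" if "y \<in> Jpow i" for y
  proof -
    have "y \<in> (\<lambda>a. a \<otimes> b) ` carrier R" using Rb that by simp
    then obtain c where c: "c \<in> carrier R" "y = c \<otimes> b" by auto
    have "bij_betw (\<lambda>a. a \<oplus> c) (fib \<zero>) (fib y)"
      by (rule bij_betw_byWitness[where f' = "\<lambda>a. a \<ominus> c"])
        (use bc c in \<open>auto simp: fib_def l_distr minus_eq l_minus a_assoc r_neg l_neg\<close>)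
    then show ?thesis by (simp add: bij_betw_same_card)
  qed
  have "q ^ n = card (\<Union>y\<in>Jpow i. fib y)"
  proof -
    have "(\<Union>y\<in>Jpow i. fib y) = carrier R" using Rb by (auto simp: fib_def)
    then show ?thesis using order_eq by (simp add: order_def)
  qed
  also have "\<dots> = (\<Sum>y\<in>Jpow i. card (fib y))"
    by (rule card_UN_disjoint) (auto simp: finite_Jpow fib_def finite_carrier)
  also have "\<dots> = q ^ (n - i) * card (fib x)"
    using card_eq card_eq[OF x] card_Jpow i by simp
  finally have "q ^ (n - i) * q ^ i = q ^ (n - i) * card (fib x)"
    using i by (simp flip: power_add)
  then show ?thesis
    using q_gt_1 by (simp add: fib_def)
qed

text \<open>The ring is the disjoint union of the layers \<open>J^i - J^(i+1)\<close> for \<open>i < m\<close> and of \<open>J^m\<close>.\<close>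

lemma sum_carrier_layers:
  fixes f :: "'a \<Rightarrow> nat"
  shows "sum f (carrier R) = (\<Sum>i<m. sum f (Jpow i - Jpow (Suc i))) + sum f (Jpow m)"
proof (induction m)
  case 0
  then show ?case by (simp add: ideal_power_0)
next
  case (Suc m)
  have "sum f (Jpow m) = sum f (Jpow m - Jpow (Suc m)) + sum f (Jpow (Suc m))"
    using Jpow_antimono[of m "Suc m"] finite_Jpow by (intro sum.subset_diff) auto
  with Suc show ?case by simp
qed

lemma card_factorizations:
  "card {(a, b) \<in> carrier R \<times> carrier R. a \<otimes> b = x}
   = (\<Sum>b\<in>carrier R. card {a \<in> carrier R. a \<otimes> b = x})"
proof -
  have "{(a, b) \<in> carrier R \<times> carrier R. a \<otimes> b = x}
      = prod.swap ` (SIGMA b:carrier R. {a \<in> carrier R. a \<otimes> b = x})"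
    by auto
  then show ?thesis
    using finite_carrier by (simp add: card_image)
qed

text \<open>Each layer of right factors contributes the same number of factorizations, since the size of
  a layer shrinks by the factor \<open>q\<close> from one layer to the next while the fibres grow by it.\<close>

lemma sum_layers:
  assumes "m \<le> n" "m \<le> Suc k" "x \<in> Jpow k"
  shows "(\<Sum>i<m. \<Sum>b\<in>Jpow i - Jpow (Suc i). card {a \<in> carrier R. a \<otimes> b = x})
    = m * ((q - 1) * q ^ (n - 1))"
proof -
  have "(\<Sum>b\<in>Jpow i - Jpow (Suc i). card {a \<in> carrier R. a \<otimes> b = x}) = (q - 1) * q ^ (n - 1)"
    if "i < m" for i
  proof -
    have i: "i < n" "i \<le> k" using that assms by auto
    have "x \<in> Jpow i" using assms Jpow_antimono[OF i(2)] by blast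
    then have "(\<Sum>b\<in>Jpow i - Jpow (Suc i). card {a \<in> carrier R. a \<otimes> b = x})
        = card (Jpow i - Jpow (Suc i)) * q ^ i"
      using card_fibre i by simp
    also have "card (Jpow i - Jpow (Suc i)) = q ^ (n - i) - q ^ (n - Suc i)"
      using i card_Jpow Jpow_antimono[of i "Suc i"] finite_Jpow by (simp add: card_Diff_subset)
    also have "\<dots> = (q - 1) * q ^ (n - Suc i)"
      using i by (simp add: diff_mult_distrib Suc_diff_Suc flip: power_Suc)
    also have "\<dots> * q ^ i = (q - 1) * q ^ (n - 1)"
      using i by (simp flip: power_add add: mult.assoc)
    finally show ?thesis .
  qed
  then show ?thesis by simp
qed

lemma card_factorizations_layer:
  assumes x: "x \<in> Jpow k - Jpow (Suc k)"
  shows "card {(a, b) \<in> carrier R \<times> carrier R. a \<otimes> b = x} = Suc k * ((q - 1) * q ^ (n - 1))"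
proof -
  have "k < n"
  proof (rule ccontr)
    assume "\<not> k < n"
    then have "Jpow k \<subseteq> {\<zero>}"
      using Jpow_antimono[of n k] Jpow_n by simp
    with x zero_in_Jpow[of "Suc k"] show False by blast
  qed
  moreover have "(\<Sum>b\<in>Jpow (Suc k). card {a \<in> carrier R. a \<otimes> b = x}) = 0"
  proof (rule sum.neutral, rule ballI)
    fix b assume "b \<in> Jpow (Suc k)"
    then have "{a \<in> carrier R. a \<otimes> b = x} = {}"
      using ideal.I_l_closed[OF ideal_Jpow] x by auto
    then show "card {a \<in> carrier R. a \<otimes> b = x} = 0"
      by (simp only: card.empty)
  qed
  ultimately show ?thesis
    using x sum_layers[of "Suc k" k x] 
    by (simp only: card_factorizations sum_carrier_layers[of _ "Suc k"]) auto
qed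

lemma card_factorizations_zero:
  "card {(a, b) \<in> carrier R \<times> carrier R. a \<otimes> b = \<zero>} = n * ((q - 1) * q ^ (n - 1)) + q ^ n"
proof -
  have "{a \<in> carrier R. a \<otimes> \<zero> = \<zero>} = carrier R" by auto
  then have "(\<Sum>b\<in>Jpow n. card {a \<in> carrier R. a \<otimes> b = \<zero>}) = q ^ n"
    using order_eq by (simp add: Jpow_n order_def)
  then show ?thesis
    using sum_layers[of n n \<zero>] zero_in_Jpow
    by (simp only: card_factorizations sum_carrier_layers[of _ n] le_refl le_SucI)
qed

lemma q_power_n: "real q ^ n = real q * real q ^ (n - 1)"
  using n_pos by (simp flip: power_Suc)

lemma mult_prob_layer:
  assumes "x \<in> Jpow k - Jpow (Suc k)"
  shows "mult_prob R x = (real k + 1) * (real q - 1) / real q ^ (n + 1)"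
  unfolding mult_prob_def card_factorizations_layer[OF assms] order_eq using q_gt_1
  by (simp add: q_power_n field_simps power2_eq_square)

lemma mult_prob_zero: "mult_prob R \<zero> = ((real n + 1) * real q - real n) / real q ^ (n + 1)"
  unfolding mult_prob_def card_factorizations_zero order_eq using q_gt_1
  by (simp add: q_power_n field_simps power2_eq_square)

end

theorem theorem4p6:
  fixes R :: "('a, 'm) ring_scheme" (structure)
    and F :: "('b, 'l) ring_scheme"
    and q n :: nat
  assumes "local_ring R"
    and "finite (carrier R)"
    and "n > 0"
    and "order R = q ^ n"
    and "is_GF F q"
    and "R Quot (jacobson_radical R) \<simeq> F"
    and "ideal_power R (jacobson_radical R) (n - 1) \<noteq> {\<zero>}"
  shows "(\<forall>k x. x \<in> ideal_power R (jacobson_radical R) k - ideal_power R (jacobson_radical R) (k + 1) \<longrightarrow>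
            mult_prob R x = (real k + 1) * (real q - 1) / real q ^ (n + 1))
         \<and> mult_prob R \<zero> = ((real n + 1) * real q - real n) / real q ^ (n + 1)"
proof -
  interpret F: field F using assms(5) by (simp add: is_GF_def)
  have F: "finite (carrier F)" "card (carrier F) = q"
    using assms(5) by (simp_all add: is_GF_def order_def)
  have "q > 1"
  proof -
    have "card {\<zero>\<^bsub>F\<^esub>, \<one>\<^bsub>F\<^esub>} \<le> card (carrier F)"
      using F by (intro card_mono) auto
    then show ?thesis using F by simp
  qed
  moreover have "card (carrier (R Quot jacobson_radical R)) = q"
    using assms(6) F by (auto simp: is_ring_iso_def ring_iso_def dest: bij_betw_same_card)
  ultimately interpret maximal_length_local_ring R q n
    using assms
    by (intro maximal_length_local_ring.intro maximal_length_local_ring_axioms.intro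
        finite_local_ring.intro finite_local_ring_axioms.intro)
  show ?thesis
    using mult_prob_layer mult_prob_zero by simp
qed

end
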